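(* There exists an absolute constant $C>0$ such that for all integers $t\ge 2$ and $s\ge 4$ with $s\ge t+1$ and $(s,t)\neq(4,2)$, and every integer $r\ge t$, $$\pi(\mathcal{D}_r^{s,t}) \geq r^{-\frac{2s-2}{\binom{s}{t}-1}-\frac{C}{\sqrt{\log r}}}$$ (that is, $\pi(\mathcal{D}_r^{s,t}) \geq r^{-\frac{2s-2}{\binom{s}{t}-1}-O(1/\sqrt{\log r})}$).
   Context: For integers $t\ge 1$, $s\ge t+1$ and $r\ge t$, an $r$-uniform $(s,t)$-daisy $\mathcal{D}_r^{s,t}$ is a family of $r$-element sets of the form $\{S\cup T : T\subset U,\ |T|=t\}$ for some sets $S,U$ with $|S|=r-t$, $|U|=s$ and $S\cap U=\emptyset$. A family of $r$-element subsets of $[n]=\{1,2,\ldots,n\}$ is $\mathcal{D}_r^{s,t}$-free if it contains no $r$-uniform $(s,t)$-daisy as a subfamily. $\mathrm{ex}(n,\mathcal{D}_r^{s,t})$ denotes the maximum possible cardinality of a $\mathcal{D}_r^{s,t}$-free family of $r$-element subsets of $[n]$, and the Turán density is $\pi(\mathcal{D}_r^{s,t})=\lim_{n\to\infty}\mathrm{ex}(n,\mathcal{D}_r^{s,t})/\binom{n}{r}$. Here $\log$ denotes the natural logarithm. The notation $f=O(h)$ means that there is an absolute constant $C>0$ with $f\le Ch$ throughout the domain. *)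

theory Defs
  imports Complex_Main
begin

text \<open>Finiteness of \<open>S\<close> and \<open>U\<close> is explicit because \<^const>\<open>card\<close> is 0 on infinite sets;
  \<open>card S + t = r\<close> expresses \<open>|S| = r - t\<close> without truncated subtraction.\<close>

definition is_daisy :: "nat \<Rightarrow> nat \<Rightarrow> nat \<Rightarrow> 'a set set \<Rightarrow> bool" where
  "is_daisy r s t D \<longleftrightarrow>
     (\<exists>S U. finite S \<and> finite U \<and> card S + t = r \<and> card U = s \<and> S \<inter> U = {} \<and>
        D = {S \<union> T |T. T \<subseteq> U \<and> card T = t})"

definition daisy_free :: "nat \<Rightarrow> nat \<Rightarrow> nat \<Rightarrow> 'a set set \<Rightarrow> bool" where
  "daisy_free r s t F \<longleftrightarrow> \<not> (\<exists>D. is_daisy r s t D \<and> D \<subseteq> F)"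

definition ex_daisy :: "nat \<Rightarrow> nat \<Rightarrow> nat \<Rightarrow> nat \<Rightarrow> nat" where
  "ex_daisy n r s t =
     Max {card F |F. F \<subseteq> {A. A \<subseteq> {1..n} \<and> card A = r} \<and> daisy_free r s t F}"

definition daisy_density :: "nat \<Rightarrow> nat \<Rightarrow> nat \<Rightarrow> real" where
  "daisy_density r s t = lim (\<lambda>n. real (ex_daisy n r s t) / real (n choose r))"

end

theory Submission
  imports Defs "HOL-Analysis.Infinite_Products" "HOL-Library.Z2" "HOL-Library.Function_Algebras"
begin

text \<open>
  Fixing all but two elements of \<open>T\<close> inside a daisy leaves a smaller daisy with a larger kernel
  \<open>S\<close>. Hence every \<open>(t + 1, t)\<close>-daisy contains a \<open>(3, 2)\<close>-daisy, and every \<open>(s, t)\<close>-daisy with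
  \<open>s \<ge> t + 2\<close> contains a \<open>(4, 2)\<close>-daisy (\<open>daisy_free_mono\<close>). Two constructions therefore suffice.

  If \<open>s = t + 1\<close>, the main exponent is exactly \<open>2\<close>. Colour the ground set by \<open>{0, \<dots>, r\<^sup>2 - 1}\<close> and keep
  the \<open>r\<close>-sets whose colours are distinct and sum to a fixed residue modulo \<open>r\<^sup>2\<close>. In a
  \<open>(3, 2)\<close>-daisy \<open>S \<union> {x, y}\<close>, \<open>S \<union> {x, z}\<close>, \<open>S \<union> {y, z}\<close> of such sets the first two force \<open>y\<close> and \<open>z\<close> to
  have the same colour, which the third forbids. By the birthday estimate a random colouring is
  injective on a given \<open>r\<close>-set with probability at least \<open>1/2\<close>, and the best residue keeps an
  \<open>r\<^sup>-\<^sup>2\<close> fraction of these sets, so the density is at least \<open>1 / (2 r\<^sup>2)\<close>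
  (\<open>rainbow_prescribed_sum_family\<close>).

  If \<open>s \<ge> t + 2\<close>, the density is bounded below by a constant. Colour the ground set by vectors of
  \<open>F\<^sub>2\<^sup>r\<close> and keep the \<open>r\<close>-sets that are mapped to bases. For a \<open>(4, 2)\<close>-daisy of such sets, the
  subspace spanned by \<open>S\<close> has four cosets, but the zero vector and the four elements of \<open>U\<close> would
  lie in five distinct ones. A random \<open>r\<close>-tuple is a basis with probability
  \<open>\<Prod>j=1..r. (1 - 2\<^sup>-\<^sup>j) \<ge> 1/4\<close> (\<open>binary_basis_family\<close>).

  The error factor absorbs both constants: for \<open>C = 2\<close> and \<open>r \<ge> 2\<close> it equals
  \<open>exp (- 2 sqrt (ln r)) \<le> 1/4\<close> (\<open>powr_error_le\<close>). To pass from families for each \<open>n\<close> to the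
  limit density, the limit must be known to exist; this is the monotonicity of the densities
  obtained by averaging over the deletion of one point (\<open>ex_daisy_Suc_le\<close>, \<open>daisy_density_ge\<close>).
\<close>

section \<open>Daisies inside daisies\<close>

lemma is_daisy_image:
  assumes "is_daisy r s t D" "inj g"
  shows "is_daisy r s t ((`) g ` D)"
proof -
  obtain S U where SU: "finite S" "finite U" "card S + t = r" "card U = s" "S \<inter> U = {}"
    "D = {S \<union> T |T. T \<subseteq> U \<and> card T = t}"
    using assms(1) unfolding is_daisy_def by blast
  have inj: "inj_on g X" for X
    using assms(2) by (rule inj_on_subset) auto
  have "(`) g ` D = {g ` S \<union> T |T. T \<subseteq> g ` U \<and> card T = t}"
  proof (intro equalityI subsetI)
    fix X assume "X \<in> (`) g ` D"
    then obtain T where "T \<subseteq> U" "card T = t" "X = g ` (S \<union> T)"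
      using SU(6) by auto
    moreover from this have "g ` T \<subseteq> g ` U" "card (g ` T) = t"
      using card_image[OF inj, of T] by auto
    ultimately show "X \<in> {g ` S \<union> T |T. T \<subseteq> g ` U \<and> card T = t}"
      using image_Un[of g S T] by blast
  next
    fix X assume "X \<in> {g ` S \<union> T |T. T \<subseteq> g ` U \<and> card T = t}"
    then obtain T where T: "T \<subseteq> g ` U" "card T = t" "X = g ` S \<union> T"
      by auto
    then obtain T' where "T' \<subseteq> U" "T = g ` T'"
      by (meson subset_imageE)
    moreover from this have "S \<union> T' \<in> D"
      using SU(6) T(2) card_image[OF inj, of T'] by auto
    ultimately show "X \<in> (`) g ` D"
      using T(3) image_Un[of g S T'] by blast
  qed
  moreover have "g ` S \<inter> g ` U = {}"
    using SU(5) assms(2) by (simp flip: image_Int)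
  moreover have "card (g ` S) = card S" "card (g ` U) = card U"
    by (rule card_image[OF inj])+
  ultimately show ?thesis
    unfolding is_daisy_def using SU(1-4)
    by - (rule exI[of _ "g ` S"], rule exI[of _ "g ` U"], simp)
qed

text \<open>Move a set \<open>W\<close> of \<open>t - t'\<close> elements from \<open>U\<close> into the kernel: the members of the daisy that
  contain \<open>W\<close> form a daisy with kernel \<open>S \<union> W\<close>.\<close>

lemma daisy_contains_smaller_daisy:
  assumes "is_daisy r s t D" "t' \<le> t" "s' + (t - t') \<le> s"
  shows "\<exists>D'\<subseteq>D. is_daisy r s' t' D'"
proof -
  obtain S U where SU: "finite S" "finite U" "card S + t = r" "card U = s" "S \<inter> U = {}"
    "D = {S \<union> T |T. T \<subseteq> U \<and> card T = t}"
    using assms(1) unfolding is_daisy_def by blast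
  have "t - t' \<le> card U"
    using SU(4) assms(3) by simp
  then obtain W where W: "W \<subseteq> U" "card W = t - t'"
    by (rule obtain_subset_with_card_n)
  have finW: "finite W"
    using W(1) SU(2) finite_subset by blast
  have "s' \<le> card (U - W)"
    using W SU(4) assms(3) by (simp add: card_Diff_subset finW)
  then obtain U' where U': "U' \<subseteq> U - W" "card U' = s'"
    by (rule obtain_subset_with_card_n)
  have finU': "finite U'"
    using U'(1) SU(2) finite_subset by blast
  define D' where "D' = {(S \<union> W) \<union> T |T. T \<subseteq> U' \<and> card T = t'}"
  have "S \<inter> W = {}"
    using SU(5) W(1) by blast
  then have card_SW: "card (S \<union> W) + t' = r"
    using W(2) SU(1,3) finW assms(2) by (simp add: card_Un_disjoint)
  have "is_daisy r s' t' D'"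
    unfolding is_daisy_def
  proof (rule exI[of _ "S \<union> W"], rule exI[of _ U'], intro conjI)
    show "(S \<union> W) \<inter> U' = {}"
      using SU(5) U'(1) by blast
    show "D' = {S \<union> W \<union> T |T. T \<subseteq> U' \<and> card T = t'}"
      by (fact D'_def)
  qed (use SU(1) finW finU' U'(2) card_SW in simp_all)
  moreover have "D' \<subseteq> D"
  proof
    fix X assume "X \<in> D'"
    then obtain T where T: "T \<subseteq> U'" "card T = t'" "X = S \<union> (W \<union> T)"
      unfolding D'_def by (auto simp: Un_assoc)
    have "finite T" "W \<inter> T = {}"
      using T(1) finU' finite_subset U'(1) by blast+
    then have "card (W \<union> T) = t"
      using T(2) W(2) finW assms(2) by (simp add: card_Un_disjoint)
    moreover have "W \<union> T \<subseteq> U"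
      using W T U' by blast
    ultimately show "X \<in> D"
      using SU(6) T(3) by blast
  qed
  ultimately show ?thesis
    by blast
qed

lemma daisy_free_mono:
  assumes "daisy_free r s' t' F" "t' \<le> t" "s' + (t - t') \<le> s"
  shows "daisy_free r s t F"
  unfolding daisy_free_def
proof
  assume "\<exists>D. is_daisy r s t D \<and> D \<subseteq> F"
  then obtain D where "is_daisy r s t D" "D \<subseteq> F"
    by blast
  moreover from this obtain D' where "D' \<subseteq> D" "is_daisy r s' t' D'"
    using daisy_contains_smaller_daisy[OF _ assms(2,3)] by blast
  ultimately show False
    using assms(1) unfolding daisy_free_def by blast
qed

section \<open>Existence of the density\<close>

lemma finite_daisy_free_cards:
  fixes n :: nat
  shows "finite {card F |F. F \<subseteq> {A. A \<subseteq> {1..n} \<and> card A = r} \<and> daisy_free r s t F}"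
proof -
  have "finite {A. A \<subseteq> {1..n} \<and> card A = r}"
    by (rule finite_subset[of _ "Pow {1..n}"]) blast+
  then have "finite (card ` Pow {A. A \<subseteq> {1..n} \<and> card A = r})"
    by blast
  then show ?thesis
    by (rule rev_finite_subset) blast
qed

lemma card_le_ex_daisy:
  assumes "F \<subseteq> {A. A \<subseteq> {1..n} \<and> card A = r}" "daisy_free r s t F"
  shows "card F \<le> ex_daisy n r s t"
  unfolding ex_daisy_def using assms
  by (intro Max_ge finite_daisy_free_cards) blast

text \<open>The condition \<open>t \<le> s\<close> makes every daisy nonempty, so that the empty family is daisy-free and
  the maximum is taken over a nonempty set.\<close>

lemma ex_daisy_attained:
  assumes "t \<le> s"
  obtains F where "F \<subseteq> {A. A \<subseteq> {1..n} \<and> card A = r}" "daisy_free r s t F"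
    "card F = ex_daisy n r s t"
proof -
  have "daisy_free r s t ({} :: nat set set)"
  proof -
    have "D \<noteq> {}" if D: "is_daisy r s t D" for D :: "nat set set"
    proof -
      obtain S U where SU: "card U = s" "D = {S \<union> T |T. T \<subseteq> U \<and> card T = t}"
        using D unfolding is_daisy_def by blast
      then have "t \<le> card U"
        using assms by simp
      then obtain T where "T \<subseteq> U" "card T = t"
        by (rule obtain_subset_with_card_n)
      then show ?thesis
        using SU(2) by blast
    qed
    then show ?thesis
      unfolding daisy_free_def by blast
  qed
  then have "{card F |F. F \<subseteq> {A. A \<subseteq> {1..n} \<and> card A = r} \<and> daisy_free r s t F} \<noteq> {}"
    by blast
  then have "ex_daisy n r s t \<in> {card F |F. F \<subseteq> {A. A \<subseteq> {1..n} \<and> card A = r} \<and> daisy_free r s t F}"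
    unfolding ex_daisy_def by (rule Max_in[OF finite_daisy_free_cards])
  then obtain F where "ex_daisy n r s t = card F" "F \<subseteq> {A. A \<subseteq> {1..n} \<and> card A = r}"
      "daisy_free r s t F"
    by blast
  then show ?thesis
    using that[of F] by simp
qed

text \<open>Delete each point \<open>i\<close> of the ground set in turn from an extremal family on \<open>n + 1\<close> points. What
  remains is daisy-free on \<open>n\<close> points, and every member survives exactly \<open>n + 1 - r\<close> deletions.\<close>

lemma ex_daisy_Suc_le:
  assumes "t \<le> s"
  shows "(Suc n - r) * ex_daisy (Suc n) r s t \<le> Suc n * ex_daisy n r s t"
proof -
  obtain F where F: "F \<subseteq> {A. A \<subseteq> {1..Suc n} \<and> card A = r}" "daisy_free r s t F"
    "card F = ex_daisy (Suc n) r s t"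
    using ex_daisy_attained[OF assms(1)] by blast
  have finF: "finite F"
    by (rule finite_subset[of _ "Pow {1..Suc n}"]) (use F(1) in auto)
  have del: "card {A\<in>F. i \<notin> A} \<le> ex_daisy n r s t" if i: "i \<in> {1..Suc n}" for i
  proof -
    \<comment> \<open>Relabel the remaining points. Choosing \<open>g\<close> injective on all of \<open>nat\<close>, not only on the ground
      set, lets any daisy be transported without first locating it.\<close>
    define g where "g j = (if j < i then j else Suc j)" for j
    have inj: "inj g"
      by (auto simp: inj_def g_def split: if_splits)
    have g: "g ` {1..n} = {1..Suc n} - {i}"
    proof
      show "g ` {1..n} \<subseteq> {1..Suc n} - {i}"
        using i by (auto simp: g_def)
      show "{1..Suc n} - {i} \<subseteq> g ` {1..n}"
      proof
        fix j assume j: "j \<in> {1..Suc n} - {i}"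
        show "j \<in> g ` {1..n}"
        proof (cases "j < i")
          case True
          then show ?thesis
            using i j by (intro image_eqI[of _ _ j]) (auto simp: g_def)
        next
          case False
          then show ?thesis
            using i j by (intro image_eqI[of _ _ "j - 1"]) (auto simp: g_def)
        qed
      qed
    qed
    define F' where "F' = {B. g ` B \<in> F \<and> i \<notin> g ` B}"
    have image: "(`) g ` F' = {A\<in>F. i \<notin> A}"
    proof
      show "{A\<in>F. i \<notin> A} \<subseteq> (`) g ` F'"
      proof
        fix A assume A: "A \<in> {A\<in>F. i \<notin> A}"
        then have "A \<subseteq> g ` {1..n}"
          using F(1) g by blast
        then obtain B where "A = g ` B"
          by (meson subset_imageE)
        then show "A \<in> (`) g ` F'"
          using A unfolding F'_def by blast
      qed
    qed (auto simp: F'_def)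
    have "inj_on ((`) g) F'"
      by (rule inj_onI) (simp add: inj_image_eq_iff[OF inj])
    then have "card {A\<in>F. i \<notin> A} = card F'"
      unfolding image[symmetric] by (rule card_image)
    also have "\<dots> \<le> ex_daisy n r s t"
    proof (rule card_le_ex_daisy)
      show "F' \<subseteq> {A. A \<subseteq> {1..n} \<and> card A = r}"
      proof
        fix B assume B: "B \<in> F'"
        then have "g ` B \<subseteq> g ` {1..n}"
          using F(1) g unfolding F'_def by blast
        moreover have "card (g ` B) = r"
          using B F(1) unfolding F'_def by blast
        moreover have "card (g ` B) = card B"
          using inj by (intro card_image) (rule inj_on_subset, auto)
        ultimately show "B \<in> {A. A \<subseteq> {1..n} \<and> card A = r}"
          using inj_image_subset_iff[OF inj] by simp
      qed
      show "daisy_free r s t F'"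
        unfolding daisy_free_def
      proof
        assume "\<exists>D. is_daisy r s t D \<and> D \<subseteq> F'"
        then obtain D where "is_daisy r s t D" "D \<subseteq> F'"
          by blast
        then have "is_daisy r s t ((`) g ` D)" "(`) g ` D \<subseteq> F"
          using is_daisy_image[OF _ inj] by (auto simp: F'_def)
        then show False
          using F(2) unfolding daisy_free_def by blast
      qed
    qed
    finally show ?thesis .
  qed
  have "(Suc n - r) * card F = (\<Sum>A\<in>F. card {i\<in>{1..Suc n}. i \<notin> A})"
  proof -
    have "card {i\<in>{1..Suc n}. i \<notin> A} = Suc n - r" if "A \<in> F" for A
    proof -
      have "A \<subseteq> {1..Suc n}" "card A = r" "finite A"
        using that F(1) finite_subset[of A "{1..Suc n}"] by auto
      moreover have "{i\<in>{1..Suc n}. i \<notin> A} = {1..Suc n} - A"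
        by auto
      ultimately show ?thesis
        by (simp add: card_Diff_subset)
    qed
    then show ?thesis
      by simp
  qed
  also have "\<dots> = (\<Sum>i\<in>{1..Suc n}. card {A\<in>F. i \<notin> A})"
    using finF by (intro sum_multicount_gen) auto
  also have "\<dots> \<le> (\<Sum>i\<in>{1..Suc n}. ex_daisy n r s t)"
    by (intro sum_mono del)
  finally show ?thesis
    using F(3) by simp
qed

text \<open>The density is defined by \<^const>\<open>lim\<close>, which says something only about convergent sequences.
  Convergence holds because the sequence decreases from index \<open>r\<close> on and is nonnegative; the limit
  then inherits any bound that holds for every \<open>n \<ge> r\<close>.\<close>

lemma daisy_density_ge:
  fixes p :: real
  assumes "t \<le> s"
    and "\<And>n. n \<ge> r \<Longrightarrow> \<exists>F \<subseteq> {A. A \<subseteq> {1..n} \<and> card A = r}.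
           daisy_free r s t F \<and> p * real (n choose r) \<le> real (card F)"
  shows "daisy_density r s t \<ge> p"
proof -
  define X where "X = (\<lambda>n. real (ex_daisy n r s t) / real (n choose r))"
  have dec: "X (Suc (d + r)) \<le> X (d + r)" for d
  proof -
    define n where "n = d + r"
    have nr: "Suc n - r = Suc d"
      by (simp add: n_def)
    have binom: "Suc d * (Suc n choose r) = Suc n * (n choose r)"
      using binomial_absorb_comp[of "Suc n" r] unfolding nr diff_Suc_1 .
    have deletion: "Suc d * ex_daisy (Suc n) r s t \<le> Suc n * ex_daisy n r s t"
      using ex_daisy_Suc_le[OF assms(1), of n r] unfolding nr .
    have "Suc d * (ex_daisy (Suc n) r s t * (n choose r)) \<le> Suc n * ex_daisy n r s t * (n choose r)"
      unfolding mult.assoc[symmetric] by (rule mult_right_mono[OF deletion]) simp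
    also have "\<dots> = ex_daisy n r s t * (Suc n * (n choose r))"
      by (simp only: mult_ac)
    also have "\<dots> = Suc d * (ex_daisy n r s t * (Suc n choose r))"
      unfolding binom[symmetric] by (simp only: mult_ac)
    finally have "ex_daisy (Suc n) r s t * (n choose r) \<le> ex_daisy n r s t * (Suc n choose r)"
      by (simp only: mult_le_cancel1)
    then have "real (ex_daisy (Suc n) r s t) * real (n choose r)
        \<le> real (ex_daisy n r s t) * real (Suc n choose r)"
      by (simp only: of_nat_mult[symmetric] of_nat_le_iff)
    moreover have "0 < n choose r" "0 < Suc n choose r"
      by (simp_all add: n_def del: binomial_Suc_Suc)
    ultimately have "real (ex_daisy (Suc n) r s t) / real (Suc n choose r)
        \<le> real (ex_daisy n r s t) / real (n choose r)"
      by (simp add: pos_divide_le_eq pos_le_divide_eq del: binomial_Suc_Suc)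
    then show ?thesis
      by (simp add: X_def n_def)
  qed
  have "decseq (\<lambda>n. X (n + r))"
    by (rule decseq_SucI) (use dec in auto)
  moreover have "\<forall>n. 0 \<le> X (n + r)"
    by (simp add: X_def)
  ultimately obtain L where "(\<lambda>n. X (n + r)) \<longlonglongrightarrow> L"
    by (rule decseq_convergent)
  then have L: "X \<longlonglongrightarrow> L"
    by (rule LIMSEQ_offset)
  have "p \<le> X n" if n: "n \<ge> r" for n
  proof -
    obtain F where F: "F \<subseteq> {A. A \<subseteq> {1..n} \<and> card A = r}" "daisy_free r s t F"
      "p * real (n choose r) \<le> real (card F)"
      using assms(2)[OF n] by blast
    then have "p * real (n choose r) \<le> real (ex_daisy n r s t)"
      using card_le_ex_daisy[OF F(1,2)] by linarith
    then show ?thesis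
      using n by (simp add: X_def pos_le_divide_eq)
  qed
  then have "p \<le> L"
    using LIMSEQ_le_const[OF L] by blast
  then show ?thesis
    unfolding daisy_density_def using limI[OF L] by (simp add: X_def)
qed

section \<open>Random colourings by counting\<close>

text \<open>The first-moment method, by counting the pairs \<open>(\<omega>, A)\<close> with \<open>A \<in> \<F> \<omega>\<close> in two ways.\<close>

lemma averaging_family:
  fixes p :: real and \<F> :: "'w \<Rightarrow> 'b set"
  assumes "finite \<Omega>" "\<Omega> \<noteq> {}" "finite \<A>"
    and "\<And>A. A \<in> \<A> \<Longrightarrow> p * real (card \<Omega>) \<le> real (card {\<omega>\<in>\<Omega>. A \<in> \<F> \<omega>})"
  shows "\<exists>\<omega>\<in>\<Omega>. p * real (card \<A>) \<le> real (card {A\<in>\<A>. A \<in> \<F> \<omega>})"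
proof (rule ccontr)
  assume "\<not> ?thesis"
  then have "(\<Sum>\<omega>\<in>\<Omega>. real (card {A\<in>\<A>. A \<in> \<F> \<omega>})) < (\<Sum>\<omega>\<in>\<Omega>. p * real (card \<A>))"
    using assms(1,2) by (intro sum_strict_mono) auto
  moreover have "(\<Sum>\<omega>\<in>\<Omega>. card {A\<in>\<A>. A \<in> \<F> \<omega>}) = (\<Sum>A\<in>\<A>. card {\<omega>\<in>\<Omega>. A \<in> \<F> \<omega>})"
    using assms(1,3) by (intro sum_multicount_gen) auto
  then have "(\<Sum>\<omega>\<in>\<Omega>. real (card {A\<in>\<A>. A \<in> \<F> \<omega>})) = (\<Sum>A\<in>\<A>. real (card {\<omega>\<in>\<Omega>. A \<in> \<F> \<omega>}))"
    by (simp only: of_nat_sum[symmetric])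
  moreover have "(\<Sum>A\<in>\<A>. p * real (card \<Omega>)) \<le> (\<Sum>A\<in>\<A>. real (card {\<omega>\<in>\<Omega>. A \<in> \<F> \<omega>}))"
    using assms(4) by (intro sum_mono)
  ultimately show False
    by (simp add: mult_ac)
qed

text \<open>For a uniformly random \<open>f\<close>, the colour \<open>f x\<close> is independent of \<open>P f\<close> and of the forbidden set
  \<open>B f\<close>, so it avoids \<open>B f\<close> with conditional probability at least \<open>1 - b / |K|\<close>. The counting proof
  swaps \<open>f x\<close> for an arbitrary permitted colour and remembers the old value, which makes the swap
  injective.\<close>

lemma resample_coordinate:
  fixes K :: "'c set" and N :: "'a set"
  assumes "finite N" "finite K" "x \<in> N"
    and P: "\<And>f c. f \<in> N \<rightarrow>\<^sub>E K \<Longrightarrow> P f \<Longrightarrow> P (f(x := c))"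
    and B: "\<And>f c. f \<in> N \<rightarrow>\<^sub>E K \<Longrightarrow> B (f(x := c)) = B f"
    and b: "\<And>f. f \<in> N \<rightarrow>\<^sub>E K \<Longrightarrow> P f \<Longrightarrow> finite (B f) \<and> card (B f) \<le> b"
  shows "(real (card K) - real b) * real (card {f \<in> N \<rightarrow>\<^sub>E K. P f})
    \<le> real (card K) * real (card {f \<in> N \<rightarrow>\<^sub>E K. P f \<and> f x \<notin> B f})"
proof -
  define Q where "Q = {f \<in> N \<rightarrow>\<^sub>E K. P f}"
  define R where "R = {f \<in> N \<rightarrow>\<^sub>E K. P f \<and> f x \<notin> B f}"
  have fin: "finite Q" "finite R"
    unfolding Q_def R_def using finite_PiE[OF assms(1), of "\<lambda>_. K"] assms(2) by auto
  have "(real (card K) - real b) * real (card Q) = (\<Sum>f\<in>Q. real (card K) - real b)"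
    by simp
  also have "\<dots> \<le> (\<Sum>f\<in>Q. real (card (K - B f)))"
  proof (rule sum_mono)
    fix f assume "f \<in> Q"
    then have "finite (B f)" "card (B f) \<le> b"
      using b unfolding Q_def by auto
    then show "real (card K) - real b \<le> real (card (K - B f))"
      using diff_card_le_card_Diff[of "B f" K] by linarith
  qed
  also have "\<dots> = real (card (Sigma Q (\<lambda>f. K - B f)))"
    using fin assms(2) by (simp add: card_SigmaI)
  also have "card (Sigma Q (\<lambda>f. K - B f)) \<le> card (R \<times> K)"
  proof (rule card_inj_on_le)
    let ?\<phi> = "\<lambda>(f, c). (f(x := c), f x)"
    show "inj_on ?\<phi> (Sigma Q (\<lambda>f. K - B f))"
    proof (rule inj_onI, clarify)
      fix f c g d
      assume eq: "f(x := c) = g(x := d)" "f x = g x"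
      then have "c = d"
        by (metis fun_upd_same)
      moreover have "f = g"
        using eq by (metis fun_upd_triv fun_upd_upd)
      ultimately show "f = g \<and> c = d"
        by simp
    qed
    show "?\<phi> ` Sigma Q (\<lambda>f. K - B f) \<subseteq> R \<times> K"
    proof clarify
      fix f c assume f: "f \<in> Q" and c: "c \<in> K" "c \<notin> B f"
      then have "f \<in> N \<rightarrow>\<^sub>E K" "P f"
        unfolding Q_def by auto
      moreover from this have "f(x := c) \<in> N \<rightarrow>\<^sub>E K"
        using c assms(3) by (auto simp: PiE_def extensional_def)
      ultimately show "f(x := c) \<in> R \<and> f x \<in> K"
        unfolding R_def using P B c assms(3) by auto
    qed
    show "finite (R \<times> K)"
      using fin assms(2) by simp
  qed
  finally show ?thesis
    by (simp add: Q_def R_def card_cartesian_product mult.commute)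
qed

text \<open>Reveal the colours of the points of \<open>A\<close> one after another, avoiding at each step the colours
  \<open>B\<close> that would spoil the property. The product is the lower bound that results for the
  probability that a random colouring is good on \<open>A\<close>. The locality conditions express that only
  colours already revealed matter.\<close>

lemma count_greedy_colourings:
  fixes K :: "'c set" and N :: "'a set"
  assumes "finite N" "finite K" "K \<noteq> {}"
    and good_empty: "\<And>f. good {} f"
    and step: "\<And>A x f. finite A \<Longrightarrow> x \<notin> A \<Longrightarrow> insert x A \<subseteq> N \<Longrightarrow> f \<in> N \<rightarrow>\<^sub>E K \<Longrightarrow>
      good A f \<Longrightarrow> f x \<notin> B A f \<Longrightarrow> good (insert x A) f"
    and good_local: "\<And>A f g. (\<And>y. y \<in> A \<Longrightarrow> f y = g y) \<Longrightarrow> good A f \<Longrightarrow> good A g"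
    and B_local: "\<And>A f g. (\<And>y. y \<in> A \<Longrightarrow> f y = g y) \<Longrightarrow> B A f = B A g"
    and B_card: "\<And>A f. finite A \<Longrightarrow> finite (B A f) \<and> card (B A f) \<le> b (card A)"
    and "A \<subseteq> N" and "\<And>i. i < card A \<Longrightarrow> b i \<le> card K"
  shows "(\<Prod>i<card A. 1 - real (b i) / real (card K)) * real (card (N \<rightarrow>\<^sub>E K))
    \<le> real (card {f \<in> N \<rightarrow>\<^sub>E K. good A f})"
proof -
  have "finite A"
    using assms(1) \<open>A \<subseteq> N\<close> finite_subset by blast
  then show ?thesis
    using \<open>A \<subseteq> N\<close> \<open>\<And>i. i < card A \<Longrightarrow> b i \<le> card K\<close>
  proof (induction A rule: finite_induct)
    case empty
    then show ?case
      using good_empty by simp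
  next
    case (insert x A)
    have k: "real (card K) > 0"
      using assms(2,3) by (simp add: card_gt_0_iff)
    have IH: "(\<Prod>i<card A. 1 - real (b i) / real (card K)) * real (card (N \<rightarrow>\<^sub>E K))
        \<le> real (card {f \<in> N \<rightarrow>\<^sub>E K. good A f})"
      using insert by auto
    have nonneg: "0 \<le> 1 - real (b (card A)) / real (card K)"
      using insert.prems(2)[of "card A"] insert.hyps k by simp
    have P: "good A (f(x := c))" if "good A f" for f c
      by (rule good_local[OF _ that]) (use insert.hyps in auto)
    have B: "B A (f(x := c)) = B A f" for f c
      by (rule B_local) (use insert.hyps in auto)
    have "(real (card K) - real (b (card A))) * real (card {f \<in> N \<rightarrow>\<^sub>E K. good A f})
      \<le> real (card K) * real (card {f \<in> N \<rightarrow>\<^sub>E K. good A f \<and> f x \<notin> B A f})"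
      by (rule resample_coordinate) (use assms(1,2) insert P B B_card in auto)
    then have "(1 - real (b (card A)) / real (card K)) * real (card {f \<in> N \<rightarrow>\<^sub>E K. good A f})
      \<le> real (card {f \<in> N \<rightarrow>\<^sub>E K. good A f \<and> f x \<notin> B A f})"
      using k by (simp add: field_simps)
    also have "\<dots> \<le> real (card {f \<in> N \<rightarrow>\<^sub>E K. good (insert x A) f})"
    proof -
      have "finite (N \<rightarrow>\<^sub>E K)"
        using assms(1,2) by (intro finite_PiE) auto
      then show ?thesis
        using step[of A x] insert by (intro of_nat_mono card_mono) auto
    qed
    finally have "(1 - real (b (card A)) / real (card K)) * real (card {f \<in> N \<rightarrow>\<^sub>E K. good A f})
      \<le> real (card {f \<in> N \<rightarrow>\<^sub>E K. good (insert x A) f})" .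
    then show ?case
      using mult_left_mono[OF IH nonneg] insert.hyps by (simp add: mult_ac)
  qed
qed

lemma finite_card_subsets_of_size: "finite {A. A \<subseteq> {1..n} \<and> card A = r}"
  "card {A. A \<subseteq> {1..n} \<and> card A = r} = n choose r"
proof -
  show "finite {A. A \<subseteq> {1..n} \<and> card A = r}"
    by (rule finite_subset[of _ "Pow {1..n}"]) blast+
  show "card {A. A \<subseteq> {1..n} \<and> card A = r} = n choose r"
    using n_subsets[of "{1..n}" r] by simp
qed

section \<open>Rainbow sets with prescribed colour sum\<close>

lemma eq_if_mod_eq_shifted:
  fixes a b d m :: nat
  assumes "(a + d) mod m = (b + d) mod m" "a < m" "b < m"
  shows "a = b"
proof -
  have "int (a + d) mod int m = int (b + d) mod int m"
    using assms(1) by (simp only: zmod_int[symmetric])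
  then have "int m dvd int a - int b"
    using mod_eq_dvd_iff[of "int (a + d)" "int m" "int (b + d)"] by simp
  then show ?thesis
    using assms(2,3) zdvd_not_zless[of "int a - int b" "int m"] zdvd_not_zless[of "int b - int a" "int m"]
    by (cases a b rule: linorder_cases) (auto simp: dvd_diff_commute)
qed

text \<open>The sample is a colouring together with a target residue \<open>c\<close>. Averaging over \<open>c\<close> as well avoids
  counting colourings with a prescribed sum: each colouring that is injective on \<open>A\<close> is compatible
  with exactly one \<open>c\<close>.\<close>

lemma rainbow_prescribed_sum_family:
  assumes "2 \<le> r"
  shows "\<exists>F \<subseteq> {A. A \<subseteq> {1..n} \<and> card A = r}.
    daisy_free r 3 2 F \<and> 1 / (2 * real r ^ 2) * real (n choose r) \<le> real (card F)"
proof -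
  define m where "m = r ^ 2"
  define N where "N = {1..n}"
  define K where "K = {..<m}"
  have m: "m > 0"
    using assms by (simp add: m_def)
  define \<Omega> where "\<Omega> = (N \<rightarrow>\<^sub>E K) \<times> K"
  define \<A> where "\<A> = {A. A \<subseteq> N \<and> card A = r}"
  define \<F> :: "(nat \<Rightarrow> nat) \<times> nat \<Rightarrow> nat set set"
    where "\<F> = (\<lambda>(f, c). {A. inj_on f A \<and> sum f A mod m = c})"
  have below: "i \<le> m" if "i < r" for i
    by (rule order_trans[OF less_imp_le[OF that]]) (simp add: m_def power2_eq_square)
  have K: "finite K" "K \<noteq> {}" "card K = m"
    using m by (auto simp: K_def)
  have finPi: "finite (N \<rightarrow>\<^sub>E K)"
    using K by (intro finite_PiE) (auto simp: N_def)
  have count: "1 / (2 * real r ^ 2) * real (card \<Omega>) \<le> real (card {\<omega>\<in>\<Omega>. A \<in> \<F> \<omega>})"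
    if A: "A \<in> \<A>" for A
  proof -
    have A': "A \<subseteq> N" "card A = r"
      using A by (auto simp: \<A>_def)
    have count: "(\<Prod>i<card A. 1 - real i / real (card K)) * real (card (N \<rightarrow>\<^sub>E K))
      \<le> real (card {f \<in> N \<rightarrow>\<^sub>E K. inj_on f A})"
    proof (rule count_greedy_colourings[where B = "\<lambda>A f. f ` A"])
      fix i assume "i < card A"
      then show "i \<le> card K"
        using below A' K by simp
    next
      fix A and f g :: "nat \<Rightarrow> nat"
      assume eq: "\<And>y. y \<in> A \<Longrightarrow> f y = g y"
      then show "f ` A = g ` A"
        by (rule image_cong[OF refl])
      assume "inj_on f A"
      then show "inj_on g A"
        using inj_on_cong[of A f g] eq by blast
    qed (use K(1,2) A'(1) in \<open>simp_all add: N_def card_image_le\<close>)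
    have half_le: "1 / 2 \<le> (\<Prod>i<card A. 1 - real i / real (card K))"
    proof -
      \<comment> \<open>Reversing the order of summation shows that the sum is at most half of \<open>r\<^sup>2\<close>.\<close>
      have "(\<Sum>i<r. real i) \<le> (\<Sum>i<r. real r - real i)"
      proof -
        have "(\<Sum>i<r. real i) \<le> (\<Sum>i<r. real (Suc i))"
          by (intro sum_mono) simp
        also have "\<dots> = (\<Sum>i<r. real (Suc (r - Suc i)))"
          by (rule sum.nat_diff_reindex[symmetric])
        also have "\<dots> = (\<Sum>i<r. real r - real i)"
          by (intro sum.cong) (auto simp: Suc_diff_Suc)
        finally show ?thesis .
      qed
      then have "2 * (\<Sum>i<r. real i) \<le> real r ^ 2"
        by (simp add: sum_subtractf power2_eq_square)
      then have "(\<Sum>i<r. real i / real m) \<le> 1 / 2"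
        using m by (simp add: sum_divide_distrib[symmetric] m_def field_simps)
      moreover have "1 - (\<Sum>i<r. real i / real m) \<le> (\<Prod>i<r. 1 - real i / real m)"
      proof (rule Weierstrass_prod_ineq)
        fix i assume "i \<in> {..<r}"
        then have "i \<le> m"
          using below by simp
        then show "real i / real m \<in> {0..1}"
          using m by simp
      qed
      ultimately show ?thesis
        using A' K by simp
    qed
    have half: "1 / 2 * real (card (N \<rightarrow>\<^sub>E K)) \<le> real (card {f \<in> N \<rightarrow>\<^sub>E K. inj_on f A})"
      using mult_right_mono[OF half_le, of "real (card (N \<rightarrow>\<^sub>E K))"] count by linarith
    have "card {f \<in> N \<rightarrow>\<^sub>E K. inj_on f A} \<le> card {\<omega>\<in>\<Omega>. A \<in> \<F> \<omega>}"
    proof (rule card_inj_on_le)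
      show "inj_on (\<lambda>f. (f, sum f A mod m)) {f \<in> N \<rightarrow>\<^sub>E K. inj_on f A}"
        by (auto simp: inj_on_def)
      show "(\<lambda>f. (f, sum f A mod m)) ` {f \<in> N \<rightarrow>\<^sub>E K. inj_on f A} \<subseteq> {\<omega>\<in>\<Omega>. A \<in> \<F> \<omega>}"
        using m by (auto simp: \<Omega>_def \<F>_def K_def)
      show "finite {\<omega>\<in>\<Omega>. A \<in> \<F> \<omega>}"
        using finPi K by (simp add: \<Omega>_def)
    qed
    moreover have "1 / (2 * real r ^ 2) * real (card \<Omega>) = 1 / 2 * real (card (N \<rightarrow>\<^sub>E K))"
      using m K by (simp add: \<Omega>_def card_cartesian_product m_def)
    ultimately show ?thesis
      using half by linarith
  qed
  have "\<exists>\<omega>\<in>\<Omega>. 1 / (2 * real r ^ 2) * real (card \<A>) \<le> real (card {A\<in>\<A>. A \<in> \<F> \<omega>})"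
  proof (rule averaging_family[OF _ _ _ count])
    show "finite \<Omega>" "\<Omega> \<noteq> {}" "finite \<A>"
      using finPi K finite_card_subsets_of_size(1) by (auto simp: \<Omega>_def \<A>_def N_def PiE_eq_empty_iff)
  qed
  then obtain f c where fc: "f \<in> N \<rightarrow>\<^sub>E K"
    "1 / (2 * real r ^ 2) * real (card \<A>) \<le> real (card {A\<in>\<A>. A \<in> \<F> (f, c)})"
    by (auto simp: \<Omega>_def)
  have "daisy_free r 3 2 {A\<in>\<A>. A \<in> \<F> (f, c)}"
    unfolding daisy_free_def
  proof clarify
    fix D :: "nat set set"
    assume D: "is_daisy r 3 2 D" "D \<subseteq> {A\<in>\<A>. A \<in> \<F> (f, c)}"
    obtain S U where SU: "finite S" "finite U" "card U = 3" "S \<inter> U = {}"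
      "D = {S \<union> T |T. T \<subseteq> U \<and> card T = 2}"
      using D(1) unfolding is_daisy_def by blast
    obtain x y z where xyz: "U = {x, y, z}" "x \<noteq> y" "y \<noteq> z" "x \<noteq> z"
      using SU(3) unfolding card_3_iff by blast
    have mem: "S \<union> T \<in> {A\<in>\<A>. A \<in> \<F> (f, c)}" if "T \<subseteq> U" "card T = 2" for T
      using that SU(5) D(2) by blast
    have "S \<union> {x, y} \<in> {A\<in>\<A>. A \<in> \<F> (f, c)}" "S \<union> {x, z} \<in> {A\<in>\<A>. A \<in> \<F> (f, c)}"
      "S \<union> {y, z} \<in> {A\<in>\<A>. A \<in> \<F> (f, c)}"
      using xyz by (intro mem; simp)+
    then have sums: "sum f (S \<union> {x, y}) mod m = sum f (S \<union> {x, z}) mod m"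
      and inj: "inj_on f (S \<union> {y, z})" and yz: "y \<in> N" "z \<in> N"
      by (auto simp: \<F>_def \<A>_def)
    have "x \<notin> S" "y \<notin> S" "z \<notin> S"
      using SU(4) xyz(1) by auto
    then have "(f y + (f x + sum f S)) mod m = (f z + (f x + sum f S)) mod m"
      using sums SU(1) xyz by (simp add: add_ac)
    moreover have "f y < m" "f z < m"
      using fc(1) yz by (auto simp: K_def PiE_def Pi_def)
    ultimately have "f y = f z"
      using eq_if_mod_eq_shifted[of "f y" "f x + sum f S" m "f z"] by blast
    then show False
      using inj xyz(3) by (auto simp: inj_on_def)
  qed
  moreover have "{A\<in>\<A>. A \<in> \<F> (f, c)} \<subseteq> {A. A \<subseteq> {1..n} \<and> card A = r}"
    by (auto simp: \<A>_def N_def)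
  ultimately show ?thesis
    using fc(2) finite_card_subsets_of_size(2)[of n r] by (auto simp: \<A>_def N_def)
qed

section \<open>Bases over the field with two elements\<close>

lemma sum_symmetric_difference_char_2:
  fixes f :: "'a \<Rightarrow> 'v::ab_group_add"
  assumes "\<And>v::'v. v + v = 0" "finite A" "finite B"
  shows "sum f A + sum f B = sum f ((A - B) \<union> (B - A))"
proof -
  have "sum f A = sum f (A - B) + sum f (A \<inter> B)" "sum f B = sum f (B - A) + sum f (A \<inter> B)"
    using assms(2,3) by (metis sum.Int_Diff add.commute Int_commute)+
  moreover have "sum f (A \<inter> B) + sum f (A \<inter> B) = 0"
    by (rule assms(1))
  moreover have "sum f ((A - B) \<union> (B - A)) = sum f (A - B) + sum f (B - A)"
    using assms by (intro sum.union_disjoint) auto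
  ultimately show ?thesis
    by (metis (no_types, lifting) add.assoc add.commute add.right_neutral)
qed

text \<open>In characteristic two, distinctness of all subset sums of \<open>f\<close> on \<open>A\<close> is linear independence of
  the family \<open>f\<close> on \<open>A\<close>, and the set of subset sums is its span. The span is closed under subtraction
  by \<open>sum_symmetric_difference_char_2\<close>, so a new vector outside the span keeps the family independent.\<close>

lemma subset_sums_insert:
  fixes f :: "'a \<Rightarrow> 'v::ab_group_add"
  assumes char2: "\<And>v::'v. v + v = 0" and "finite A" "x \<notin> A"
    and inj: "inj_on (sum f) (Pow A)" and fx: "f x \<notin> sum f ` Pow A"
  shows "inj_on (sum f) (Pow (insert x A))"
proof (rule inj_onI)
  have mixed: False if "B \<subseteq> insert x A" "C \<subseteq> insert x A" "sum f B = sum f C" "x \<in> B" "x \<notin> C" for B C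
  proof -
    have fin: "finite B" "finite C"
      using that assms(2) by (auto intro: finite_subset)
    have "sum f C = f x + sum f (B - {x})"
      using that fin by (simp add: sum.remove)
    then have "f x = sum f C - sum f (B - {x})"
      by simp
    also have "\<dots> = sum f C + sum f (B - {x})"
      using char2[of "sum f (B - {x})"] by (metis add_uminus_conv_diff eq_neg_iff_add_eq_0)
    also have "\<dots> \<in> sum f ` Pow A"
      using that fin by (subst sum_symmetric_difference_char_2[OF char2]) auto
    finally show False
      using fx by simp
  qed
  fix B C assume BC: "B \<in> Pow (insert x A)" "C \<in> Pow (insert x A)" "sum f B = sum f C"
  have fin: "finite B" "finite C"
    using BC assms(2) by (auto intro: finite_subset)
  consider "x \<in> B" "x \<in> C" | "x \<notin> B" "x \<notin> C"
    using mixed[of B C] mixed[of C B] BC by auto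
  then show "B = C"
  proof cases
    case 1
    then have "sum f (B - {x}) = sum f (C - {x})"
      using BC fin by (simp add: sum.remove)
    then have "B - {x} = C - {x}"
      using BC by (intro inj_onD[OF inj]) auto
    then show ?thesis
      using 1 by blast
  next
    case 2
    then show ?thesis
      using BC by (intro inj_onD[OF inj]) auto
  qed
qed

text \<open>The bound \<open>1/4\<close> alone is not preserved when a factor is added; the summand
  \<open>1 / 2 ^ (r + 1)\<close>, which tends to \<open>0\<close>, makes the induction work.\<close>

lemma prod_one_minus_powers_of_half:
  assumes "1 \<le> r"
  shows "1 / 4 + 1 / 2 ^ (r + 1) \<le> (\<Prod>j<r. 1 - 1 / 2 ^ Suc j :: real)"
  using assms
proof (induction r rule: nat_induct_at_least)
  case base
  then show ?case
    by simp
next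
  case (Suc r)
  define q :: real where "q = 1 / 2 ^ r"
  have q: "0 < q" "q \<le> 1 / 2"
    using Suc.hyps power_increasing[of 1 r "2::real"] by (auto simp: q_def field_simps)
  have "1 / 4 + q / 4 \<le> (1 / 4 + q / 2) * (1 - q / 2)"
    using q mult_left_mono[of q "1/2" q] by (simp add: algebra_simps)
  also have "\<dots> \<le> (\<Prod>j<r. 1 - 1 / 2 ^ Suc j) * (1 - q / 2)"
    using Suc.IH q by (intro mult_right_mono) (auto simp: q_def)
  finally show ?case
    by (simp add: q_def mult.commute)
qed

lemma card_binary_vectors:
  defines "V \<equiv> \<lambda>r. {v :: nat \<Rightarrow> bit. \<forall>i\<ge>r. v i = 0}"
  shows "finite (V r)" "card (V r) = 2 ^ r"
proof -
  have "bij_betw (\<lambda>I i. if i \<in> I then 1 else 0) (Pow {..<r}) (V r)"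
  proof (rule bij_betwI[where g = "\<lambda>v. {i. v i = 1}"])
    show "(\<lambda>I i. if i \<in> I then 1 else 0) \<in> Pow {..<r} \<rightarrow> V r"
      by (auto simp: V_def)
    show "(\<lambda>v. {i. v i = 1}) \<in> V r \<rightarrow> Pow {..<r}"
      by (auto simp: V_def not_le[symmetric])
  qed (auto simp: fun_eq_iff)
  then show "finite (V r)" "card (V r) = 2 ^ r"
    by (auto dest: bij_betw_finite bij_betw_same_card simp: card_Pow)
qed

text \<open>An \<open>r\<close>-set is mapped to a basis of the \<open>r\<close>-dimensional space \<open>V\<close> exactly if its subset sums are
  distinct. The pigeonhole step needs only this: \<open>S\<close> has \<open>2 ^ (r - 2)\<close> subset sums, and their
  translates by \<open>0\<close> and by the four vectors of \<open>U\<close> are pairwise disjoint, because any two of these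
  translates occur among the subset sums of one member of the daisy. This gives
  \<open>5 * 2 ^ (r - 2) > 2 ^ r\<close> elements of \<open>V\<close>.\<close>

lemma binary_basis_family:
  assumes "2 \<le> r"
  shows "\<exists>F \<subseteq> {A. A \<subseteq> {1..n} \<and> card A = r}.
    daisy_free r 4 2 F \<and> 1 / 4 * real (n choose r) \<le> real (card F)"
proof -
  define V where "V = {v :: nat \<Rightarrow> bit. \<forall>i\<ge>r. v i = 0}"
  define N where "N = {1..n}"
  have V: "finite V" "card V = 2 ^ r"
    using card_binary_vectors[of r] by (simp_all add: V_def)
  have char2: "v + v = 0" for v :: "nat \<Rightarrow> bit"
    by (auto simp: fun_eq_iff)
  have "0 \<in> V"
    by (simp add: V_def)
  have sumV: "sum f A \<in> V" if "f \<in> N \<rightarrow>\<^sub>E V" "A \<subseteq> N" for f A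
  proof -
    have "sum f A i = (\<Sum>a\<in>A. f a i)" for i
      by (induction A rule: infinite_finite_induct) auto
    then show ?thesis
      using that by (auto simp: V_def PiE_def Pi_def intro!: sum.neutral)
  qed
  define \<A> where "\<A> = {A. A \<subseteq> N \<and> card A = r}"
  define \<F> :: "(nat \<Rightarrow> nat \<Rightarrow> bit) \<Rightarrow> nat set set"
    where "\<F> = (\<lambda>f. {A. inj_on (sum f) (Pow A)})"
  have count: "1 / 4 * real (card (N \<rightarrow>\<^sub>E V)) \<le> real (card {f \<in> N \<rightarrow>\<^sub>E V. A \<in> \<F> f})"
    if A: "A \<in> \<A>" for A
  proof -
    have A': "A \<subseteq> N" "card A = r"
      using A by (auto simp: \<A>_def)
    have count: "(\<Prod>i<card A. 1 - real (2 ^ i) / real (card V)) * real (card (N \<rightarrow>\<^sub>E V))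
      \<le> real (card {f \<in> N \<rightarrow>\<^sub>E V. inj_on (sum f) (Pow A)})"
    proof (rule count_greedy_colourings[where B = "\<lambda>A f. sum f ` Pow A"
          and good = "\<lambda>A f. inj_on (sum f) (Pow A)" and b = "\<lambda>i. 2 ^ i"])
      fix A x and f :: "nat \<Rightarrow> nat \<Rightarrow> bit"
      assume "finite A" "x \<notin> A" "inj_on (sum f) (Pow A)" "f x \<notin> sum f ` Pow A"
      then show "inj_on (sum f) (Pow (insert x A))"
        by (intro subset_sums_insert char2)
    next
      fix A and f g :: "nat \<Rightarrow> nat \<Rightarrow> bit"
      assume eq: "\<And>y. y \<in> A \<Longrightarrow> f y = g y"
      have sums: "sum f C = sum g C" if "C \<in> Pow A" for C
        by (rule sum.cong) (use that eq in auto)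
      then show "sum f ` Pow A = sum g ` Pow A"
        by (rule image_cong[OF refl])
      assume "inj_on (sum f) (Pow A)"
      then show "inj_on (sum g) (Pow A)"
        using inj_on_cong[of "Pow A" "sum f" "sum g"] sums by blast
    next
      fix A :: "nat set" and f :: "nat \<Rightarrow> nat \<Rightarrow> bit"
      assume "finite A"
      then show "finite (sum f ` Pow A) \<and> card (sum f ` Pow A) \<le> 2 ^ card A"
        using card_image_le[of "Pow A" "sum f"] by (simp add: card_Pow)
    next
      fix i assume "i < card A"
      then show "2 ^ i \<le> card V"
        using A' V by simp
    qed (use V(1) A'(1) \<open>0 \<in> V\<close> in \<open>auto simp: N_def\<close>)
    have prod: "(\<Prod>i<card A. 1 - real (2 ^ i) / real (card V)) = (\<Prod>j<r. 1 - 1 / 2 ^ Suc j)"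
    proof -
      have "(\<Prod>i<card A. 1 - real (2 ^ i) / real (card V)) = (\<Prod>i<r. 1 - 1 / 2 ^ Suc (r - Suc i))"
        using A' V by (intro prod.cong) (auto simp: Suc_diff_Suc power_diff field_simps)
      then show ?thesis
        using prod.nat_diff_reindex[of "\<lambda>j. 1 - 1 / 2 ^ Suc j :: real" r] by simp
    qed
    have "1 / 4 \<le> 1 / 4 + (1 / 2 ^ (r + 1) :: real)" "1 \<le> r"
      using assms by simp_all
    then have quarter_le: "1 / 4 \<le> (\<Prod>j<r. 1 - 1 / 2 ^ Suc j :: real)"
      using prod_one_minus_powers_of_half[of r] by linarith
    show ?thesis
      using mult_right_mono[OF quarter_le, of "real (card (N \<rightarrow>\<^sub>E V))"] count
      unfolding prod \<F>_def mem_Collect_eq by linarith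
  qed
  have "\<exists>f\<in>N \<rightarrow>\<^sub>E V. 1 / 4 * real (card \<A>) \<le> real (card {A\<in>\<A>. A \<in> \<F> f})"
  proof (rule averaging_family[OF _ _ _ count])
    show "finite (N \<rightarrow>\<^sub>E V)"
      using V by (intro finite_PiE) (auto simp: N_def)
    show "N \<rightarrow>\<^sub>E V \<noteq> {}"
      using \<open>0 \<in> V\<close> by (auto simp: PiE_eq_empty_iff)
    show "finite \<A>"
      using finite_card_subsets_of_size(1) by (simp add: \<A>_def N_def)
  qed
  then obtain f where f: "f \<in> N \<rightarrow>\<^sub>E V"
    "1 / 4 * real (card \<A>) \<le> real (card {A\<in>\<A>. A \<in> \<F> f})"
    by auto
  have "daisy_free r 4 2 {A\<in>\<A>. A \<in> \<F> f}"
    unfolding daisy_free_def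
  proof clarify
    fix D :: "nat set set"
    assume D: "is_daisy r 4 2 D" "D \<subseteq> {A\<in>\<A>. A \<in> \<F> f}"
    obtain S U where SU: "finite S" "finite U" "card S + 2 = r" "card U = 4" "S \<inter> U = {}"
      "D = {S \<union> T |T. T \<subseteq> U \<and> card T = 2}"
      using D(1) unfolding is_daisy_def by blast
    have mem: "S \<union> T \<subseteq> N \<and> inj_on (sum f) (Pow (S \<union> T))" if "T \<subseteq> U" "card T = 2" for T
      using that SU(6) D(2) by (auto simp: \<A>_def \<F>_def)
    have pair: "\<exists>T\<subseteq>U. card T = 2 \<and> E \<union> E' \<subseteq> T"
      if "E \<in> insert {} ((\<lambda>u. {u}) ` U)" "E' \<in> insert {} ((\<lambda>u. {u}) ` U)" for E E'
    proof -
      have "E \<union> E' \<subseteq> U" "card (E \<union> E') \<le> 2"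
        using that by (auto simp: card_insert_if)
      then show ?thesis
        using exists_subset_between[of "E \<union> E'" 2 U] SU by auto
    qed
    \<comment> \<open>The second components index the five translates; the empty set stands for translation by \<open>0\<close>.\<close>
    define Q where "Q = Pow S \<times> insert {} ((\<lambda>u. {u}) ` U)"
    have "inj_on (\<lambda>(R, E). sum f (R \<union> E)) Q"
    proof (rule inj_onI, clarify)
      fix R E R' E'
      assume Q: "(R, E) \<in> Q" "(R', E') \<in> Q" and eq: "sum f (R \<union> E) = sum f (R' \<union> E')"
      obtain T where T: "T \<subseteq> U" "card T = 2" "E \<union> E' \<subseteq> T"
        using pair[of E E'] Q by (auto simp: Q_def)
      have "R \<union> E = R' \<union> E'"
        by (rule inj_onD[of "sum f" "Pow (S \<union> T)"]) (use mem[OF T(1,2)] eq Q T in \<open>auto simp: Q_def\<close>)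
      moreover have "R \<subseteq> S" "R' \<subseteq> S" "E \<subseteq> U" "E' \<subseteq> U"
        using Q by (auto simp: Q_def)
      ultimately show "R = R' \<and> E = E'"
        using SU(5) by blast
    qed
    moreover have "(\<lambda>(R, E). sum f (R \<union> E)) ` Q \<subseteq> V"
    proof clarify
      fix R E assume Q: "(R, E) \<in> Q"
      then obtain T where T: "T \<subseteq> U" "card T = 2" "E \<subseteq> T"
        using pair[of E E] by (auto simp: Q_def)
      then show "sum f (R \<union> E) \<in> V"
        using mem[OF T(1,2)] Q by (intro sumV[OF f(1)]) (auto simp: Q_def)
    qed
    ultimately have "card Q \<le> card V"
      using V(1) card_inj_on_le by blast
    moreover have "card Q = 5 * 2 ^ card S"
    proof -
      have "card (insert {} ((\<lambda>u. {u}) ` U)) = 5"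
        using SU by (subst card_insert_disjoint) (auto simp: card_image)
      then show ?thesis
        using SU by (simp add: Q_def card_cartesian_product card_Pow)
    qed
    moreover have "card V = 4 * 2 ^ card S"
      using V(2) SU(3)[symmetric] by simp
    ultimately show False
      by simp
  qed
  moreover have "{A\<in>\<A>. A \<in> \<F> f} \<subseteq> {A. A \<subseteq> {1..n} \<and> card A = r}"
    by (auto simp: \<A>_def N_def)
  ultimately show ?thesis
    using f(2) finite_card_subsets_of_size(2)[of n r] by (auto simp: \<A>_def N_def)
qed

section \<open>The density of daisies\<close>

text \<open>The left-hand side is \<open>exp (- 2 sqrt (ln r))\<close>, and \<open>sqrt (ln r) \<ge> sqrt (ln 2) \<ge> ln 2\<close> since
  \<open>ln 2 \<le> 1\<close>.\<close>

lemma powr_error_le: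
  assumes "2 \<le> r"
  shows "real r powr (- 2 / sqrt (ln (real r))) \<le> 1 / 4"
proof -
  have ln: "0 < ln (2::real)" "ln 2 \<le> ln (real r)" "ln 2 \<le> (1::real)"
    using assms ln_2_less_1 by auto
  have "ln 2 \<le> sqrt (ln 2 :: real)"
    using ln by (intro real_le_rsqrt) (simp add: power2_eq_square mult_le_one mult_left_le)
  also have "\<dots> \<le> sqrt (ln (real r))"
    using ln by simp
  also have "\<dots> = ln (real r) / sqrt (ln (real r))"
    by (rule real_div_sqrt[symmetric]) (use ln in linarith)
  finally have "- 2 / sqrt (ln (real r)) * ln (real r) \<le> - (2 * ln 2)"
    by (simp add: mult.commute)
  then have "real r powr (- 2 / sqrt (ln (real r))) \<le> exp (- (2 * ln 2))"
    using assms by (simp add: powr_def)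
  also have "exp (- (2 * ln 2)) = (1 / 4 :: real)"
    using exp_double[of "ln 2 :: real"] by (simp add: exp_minus field_simps)
  finally show ?thesis .
qed

theorem theorem1p10:
  "\<exists>C::real. C > 0 \<and>
     (\<forall>(t::nat) (s::nat) (r::nat).
        t \<ge> 2 \<longrightarrow> s \<ge> 4 \<longrightarrow> s \<ge> t + 1 \<longrightarrow> (s, t) \<noteq> (4, 2) \<longrightarrow> r \<ge> t \<longrightarrow>
        daisy_density r s t \<ge>
          real r powr (- ((2 * real s - 2) / (real (s choose t) - 1)) - C / sqrt (ln (real r))))"
proof (intro exI[of _ 2] conjI allI impI)
  fix t s r :: nat
  assume ts: "t \<ge> 2" "s \<ge> 4" "s \<ge> t + 1" "r \<ge> t"
  define e where "e = (2 * real s - 2) / (real (s choose t) - 1)"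
  have r: "2 \<le> r"
    using ts by simp
  have split: "real r powr (- e - 2 / sqrt (ln (real r)))
      = real r powr (- e) * real r powr (- 2 / sqrt (ln (real r)))"
    by (simp add: powr_add[symmetric])
  have "real r powr (- e - 2 / sqrt (ln (real r))) \<le> daisy_density r s t"
  proof (cases "s = t + 1")
    case True
    \<comment> \<open>Here the binomial coefficient is \<open>s\<close>, so that the exponent is \<open>(2 s - 2) / (s - 1)\<close>.\<close>
    then have "e = 2"
      using ts by (simp add: e_def field_simps)
    then have "real r powr (- e - 2 / sqrt (ln (real r))) \<le> real r powr (- 2) * (1 / 4)"
      unfolding split using powr_error_le[OF r] by (intro mult_mono) auto
    also have "\<dots> \<le> 1 / (2 * real r ^ 2)"
      using r by (simp add: powr_minus powr_numeral field_simps)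
    also have "\<dots> \<le> daisy_density r s t"
    proof (rule daisy_density_ge)
      fix n
      have "daisy_free r s t F" if "daisy_free r 3 2 F" for F :: "nat set set"
        using that by (rule daisy_free_mono) (use ts True in simp_all)
      then show "\<exists>F \<subseteq> {A. A \<subseteq> {1..n} \<and> card A = r}.
          daisy_free r s t F \<and> 1 / (2 * real r ^ 2) * real (n choose r) \<le> real (card F)"
        using rainbow_prescribed_sum_family[OF r, of n] by blast
    qed (use ts in simp)
    finally show ?thesis .
  next
    case False
    have "1 \<le> s choose t"
      using ts by (simp add: Suc_leI)
    then have "0 \<le> e"
      using ts unfolding e_def by (intro divide_nonneg_nonneg) auto
    then have "real r powr (- e) \<le> 1"
      using r powr_mono[of "- e" 0 "real r"] by simp
    then have "real r powr (- e - 2 / sqrt (ln (real r))) \<le> 1 / 4"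
      unfolding split using powr_error_le[OF r] mult_mono[of "real r powr (- e)" 1 _ "1 / 4"]
      by simp
    also have "\<dots> \<le> daisy_density r s t"
    proof (rule daisy_density_ge)
      fix n
      have "daisy_free r s t F" if "daisy_free r 4 2 F" for F :: "nat set set"
        using that by (rule daisy_free_mono) (use ts False in simp_all)
      then show "\<exists>F \<subseteq> {A. A \<subseteq> {1..n} \<and> card A = r}.
          daisy_free r s t F \<and> 1 / 4 * real (n choose r) \<le> real (card F)"
        using binary_basis_family[OF r, of n] by blast
    qed (use ts in simp)
    finally show ?thesis .
  qed
  then show "daisy_density r s t \<ge>
      real r powr (- ((2 * real s - 2) / (real (s choose t) - 1)) - 2 / sqrt (ln (real r)))"
    by (simp add: e_def)
qed simp

end
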